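(* Let $(X,d)$ be a compact metric space, let $(a_n)_{n\in\mathbb{N}}$ be a sequence in $X$, and let $F:X\to\mathbb{R}$ be a continuous function. Then one can define a primitive recursive functional $\Phi$ (in the sense of Kleene's schemata S1–S8) with the following property. For all functions $\omega,\alpha,\rho:\mathbb{N}\to\mathbb{N}$, $g:\mathbb{N}^2\to\mathbb{N}^{\mathbb{N}}$ and $h:\mathbb{N}\to\mathbb{N}^{\mathbb{N}}$ such that (i) $\forall x\in X\,\forall k\in\mathbb{N}\,\exists\, 0\le i\le \alpha(k)\,\big(d(x,a_i)<2^{-k}\big)$; (ii) for all $i,j\in\mathbb{N}$, $g(i,j)$ is a name of the real number $d(a_i,a_j)$; (iii) $\omega$ is a modulus of uniform continuity of $F$, i.e. $\forall k\in\mathbb{N}\,\forall x,y\in X\,\big(d(x,y)<2^{-\omega(k)}\to |F(x)-F(y)|<2^{-k}\big)$; (iv) for each $i\in\mathbb{N}$, $h(i)$ is a name of the real number $F(a_i)$; (v) $\rho$ is a modulus of regularity for $F$ with respect to $\mathrm{zer}\,F$, and provided that $\mathrm{zer}\,F:=\{x\in X: F(x)=0\}\neq\emptyset$, the function $\beta:=\Phi(\omega,\alpha,g,h,\rho):\mathbb{N}\to\mathbb{N}$ is such that the sequence $(a_{\beta(k)})_{k\in\mathbb{N}}$ converges with rate $2^{-k}$ to a zero of $F$, i.e. there is $x\in\mathrm{zer}\,F$ with $d(a_{\beta(k)},x)\le 2^{-k}$ for all $k\in\mathbb{N}$.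
   Context: A name of a real number $x$ is a function $f:\mathbb{N}\to\mathbb{N}$ which, via a fixed primitive recursive coding of rational numbers by natural numbers, encodes a sequence of rationals $(q_n)_{n\in\mathbb{N}}$ with $|x-q_n|\le 2^{-n}$ for all $n$ (so $q_n$ is a $2^{-n}$-rational approximation of $x$ computable from $f$). A function $\rho:\mathbb{N}\to\mathbb{N}$ is a modulus of regularity for $F:X\to\mathbb{R}$ with respect to $\mathrm{zer}\,F$ if for all $n\in\mathbb{N}$ and all $x\in X$: if $|F(x)|<2^{-\rho(n)}$ then there exists $z'\in\mathrm{zer}\,F$ with $d(x,z')<2^{-n}$. *)

theory Defs
  imports "HOL-Analysis.Analysis" "HOL-Library.Nat_Bijection"
begin

text \<open>
  A functional takes a list of arguments of type 0, a list of arguments of type 1 and a list of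
  arguments of type 2, and returns a number. As in Kleene's \<^emph>\<open>Recursive functionals and quantifiers
  of finite types\<close>, only the order of arguments of the same type matters.
\<close>

type_synonym functional =
  "nat list \<Rightarrow> (nat \<Rightarrow> nat) list \<Rightarrow> ((nat \<Rightarrow> nat) \<Rightarrow> nat) list \<Rightarrow> nat"

definition to_front :: "nat \<Rightarrow> 'b list \<Rightarrow> 'b list" where
  "to_front k xs = xs ! k # take k xs @ drop (Suc k) xs"

text \<open>
  Kleene's schemata S1--S8. The predicate carries the numbers \<open>l\<close>, \<open>m\<close>, \<open>n\<close> of arguments of type
  0, 1, 2; only the values of a functional on lists of these lengths are meaningful.
  Arguments of type 3 or more are omitted: S8 for a type-\<open>j\<close> argument adds an argument of type
  \<open>j - 2\<close> and S4, S5 add arguments of type 0, so a description of a functional whose arguments have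
  type at most 2 never involves higher ones. (For the same reason S8 cannot occur in the
  description of a functional with \<open>n = 0\<close>.)
\<close>

inductive kleene_primrec :: "nat \<Rightarrow> nat \<Rightarrow> nat \<Rightarrow> functional \<Rightarrow> bool" where
  S1: "kleene_primrec (Suc l) m n (\<lambda>xs fs Fs. Suc (hd xs))"
| S2: "kleene_primrec l m n (\<lambda>xs fs Fs. q)"
| S3: "kleene_primrec (Suc l) m n (\<lambda>xs fs Fs. hd xs)"
| S4: "kleene_primrec (Suc l) m n \<psi> \<Longrightarrow> kleene_primrec l m n \<theta> \<Longrightarrow>
    kleene_primrec l m n (\<lambda>xs fs Fs. \<psi> (\<theta> xs fs Fs # xs) fs Fs)"
| S5: "kleene_primrec l m n \<psi> \<Longrightarrow> kleene_primrec (Suc (Suc l)) m n \<theta> \<Longrightarrow>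
    kleene_primrec (Suc l) m n
      (\<lambda>xs fs Fs. rec_nat (\<psi> (tl xs) fs Fs) (\<lambda>x y. \<theta> (x # y # tl xs) fs Fs) (hd xs))"
| S6_0: "kleene_primrec l m n \<psi> \<Longrightarrow> k < l \<Longrightarrow>
    kleene_primrec l m n (\<lambda>xs fs Fs. \<psi> (to_front k xs) fs Fs)"
| S6_1: "kleene_primrec l m n \<psi> \<Longrightarrow> k < m \<Longrightarrow>
    kleene_primrec l m n (\<lambda>xs fs Fs. \<psi> xs (to_front k fs) Fs)"
| S6_2: "kleene_primrec l m n \<psi> \<Longrightarrow> k < n \<Longrightarrow>
    kleene_primrec l m n (\<lambda>xs fs Fs. \<psi> xs fs (to_front k Fs))"
| S7: "kleene_primrec (Suc l) (Suc m) n (\<lambda>xs fs Fs. hd fs (hd xs))"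
| S8: "kleene_primrec (Suc l) m (Suc n) \<theta> \<Longrightarrow>
    kleene_primrec l m (Suc n) (\<lambda>xs fs Fs. hd Fs (\<lambda>t. \<theta> (t # xs) fs Fs))"

text \<open>
  Kleene's arguments are of pure type; functions \<open>\<nat> \<rightarrow> \<nat>\<^sup>\<nat>\<close> and \<open>\<nat>\<^sup>2 \<rightarrow> \<nat>\<^sup>\<nat>\<close> are presented as
  arguments of type 1 through the (primitive recursive) Cantor pairing:
  \<open>code1 h \<langle>i, m\<rangle> = h i m\<close> and \<open>code2 g \<langle>\<langle>i, j\<rangle>, m\<rangle> = g (i, j) m\<close>.
\<close>

definition code1 :: "(nat \<Rightarrow> nat \<Rightarrow> nat) \<Rightarrow> nat \<Rightarrow> nat" where
  "code1 h = (\<lambda>c. case prod_decode c of (i, m) \<Rightarrow> h i m)"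

definition code2 :: "(nat \<times> nat \<Rightarrow> nat \<Rightarrow> nat) \<Rightarrow> nat \<Rightarrow> nat" where
  "code2 g = code1 (\<lambda>p. g (prod_decode p))"

text \<open>
  The coding of rationals: \<open>\<langle>p, q\<rangle>\<close> codes \<open>(p/2)/(q+1)\<close> for even \<open>p\<close> and \<open>-((p+1)/2)/(q+1)\<close> for
  odd \<open>p\<close>. Every rational has (many) codes.
\<close>

definition rat_of_code :: "nat \<Rightarrow> rat" where
  "rat_of_code c = (case prod_decode c of (p, q) \<Rightarrow> of_int (int_decode p) / of_nat (Suc q))"

definition is_name :: "(nat \<Rightarrow> nat) \<Rightarrow> real \<Rightarrow> bool" where
  "is_name f x \<longleftrightarrow> (\<forall>n. \<bar>x - of_rat (rat_of_code (f n))\<bar> \<le> 1 / 2 ^ n)"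

definition zer :: "'a set \<Rightarrow> ('a \<Rightarrow> real) \<Rightarrow> 'a set" where
  "zer X F = {x \<in> X. F x = 0}"

definition modulus_of_uniform_continuity ::
    "'a set \<Rightarrow> ('a \<Rightarrow> 'a \<Rightarrow> real) \<Rightarrow> ('a \<Rightarrow> real) \<Rightarrow> (nat \<Rightarrow> nat) \<Rightarrow> bool" where
  "modulus_of_uniform_continuity X d F \<omega> \<longleftrightarrow>
    (\<forall>k. \<forall>x\<in>X. \<forall>y\<in>X. d x y < 1 / 2 ^ \<omega> k \<longrightarrow> \<bar>F x - F y\<bar> < 1 / 2 ^ k)"

definition modulus_of_regularity ::
    "'a set \<Rightarrow> ('a \<Rightarrow> 'a \<Rightarrow> real) \<Rightarrow> ('a \<Rightarrow> real) \<Rightarrow> (nat \<Rightarrow> nat) \<Rightarrow> bool" where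
  "modulus_of_regularity X d F \<rho> \<longleftrightarrow>
    (\<forall>n. \<forall>x\<in>X. \<bar>F x\<bar> < 1 / 2 ^ \<rho> n \<longrightarrow> (\<exists>z\<in>zer X F. d x z < 1 / 2 ^ n))"

end

theory Submission
  imports Defs
begin

text \<open>
  Given an index \<open>p\<close> whose point \<open>a p\<close> is within \<open>2\<^sup>-\<^sup>n\<close> of some zero \<open>z\<close>, the covering modulus \<open>\<alpha>\<close>
  bounds the index \<open>i\<close> of a point so close to \<open>z\<close> that \<open>a i\<close> is near \<open>a p\<close> and, by \<open>\<omega>\<close>,
  \<open>F (a i)\<close> is tiny. Both properties can be tested on rational approximations, hence such an \<open>i\<close> is found by bounded
  search; conversely, by the modulus of regularity \<open>\<rho>\<close>, every \<open>i\<close> passing the test is again within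
  \<open>2\<^sup>-\<^sup>n\<^sup>-\<^sup>1\<close> of a (possibly different) zero. Iterating gives a Cauchy sequence with geometric rate,
  whose limit is a limit of zeros and therefore a zero. The iteration uses only primitive
  recursion and bounded search.
\<close>

section \<open>Closure properties of Kleene's schemata\<close>

text \<open>Agreement is demanded only on lists of the declared lengths, where a functional is
  meaningful. There are no type-2 arguments, as the moduli and the coded names are all of type
  1.\<close>

definition definable ::
    "nat \<Rightarrow> nat \<Rightarrow> (nat list \<Rightarrow> (nat \<Rightarrow> nat) list \<Rightarrow> nat) \<Rightarrow> bool" where
  "definable l m f \<longleftrightarrow> (\<exists>\<psi>. kleene_primrec l m 0 \<psi> \<and>
    (\<forall>xs fs. length xs = l \<longrightarrow> length fs = m \<longrightarrow> \<psi> xs fs [] = f xs fs))"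

lemma definableI:
  assumes "kleene_primrec l m 0 \<psi>"
    and "\<And>xs fs. length xs = l \<Longrightarrow> length fs = m \<Longrightarrow> \<psi> xs fs [] = f xs fs"
  shows "definable l m f"
  using assms unfolding definable_def by blast

lemma definable_cong:
  assumes "definable l m f"
    and "\<And>xs fs. length xs = l \<Longrightarrow> length fs = m \<Longrightarrow> f xs fs = g xs fs"
  shows "definable l m g"
  using assms unfolding definable_def by simp

lemma length_to_front: "k < length xs \<Longrightarrow> length (to_front k xs) = length xs"
  by (simp add: to_front_def)

lemma to_front_map: "k < length xs \<Longrightarrow> to_front k (map f xs) = map f (to_front k xs)"
  by (simp add: to_front_def take_map drop_map)

lemma set_to_front: "k < length xs \<Longrightarrow> set (to_front k xs) \<subseteq> set xs"
  using set_take_subset[of k xs] set_drop_subset[of "Suc k" xs] by (auto simp: to_front_def)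

lemma definable_const: "definable l m (\<lambda>xs fs. q)"
  by (rule definableI[OF S2]) simp

text \<open>S6 moves the wanted argument to the front, where S3 reads it.\<close>

lemma definable_nth: "k < l \<Longrightarrow> definable l m (\<lambda>xs fs. xs ! k)"
proof (cases l)
  case (Suc l')
  assume "k < l"
  then have "kleene_primrec l m 0 (\<lambda>xs fs Fs. hd (to_front k xs))"
    unfolding Suc by (rule S6_0[OF S3])
  then show ?thesis
    by (rule definableI) (simp add: to_front_def)
qed simp

lemma definable_Cons:
  assumes "definable (Suc l) m f" "definable l m g"
  shows "definable l m (\<lambda>xs fs. f (g xs fs # xs) fs)"
proof -
  obtain \<psi> \<theta> where *: "kleene_primrec (Suc l) m 0 \<psi>" "kleene_primrec l m 0 \<theta>"
    and "\<And>xs fs. length xs = Suc l \<Longrightarrow> length fs = m \<Longrightarrow> \<psi> xs fs [] = f xs fs"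
    and "\<And>xs fs. length xs = l \<Longrightarrow> length fs = m \<Longrightarrow> \<theta> xs fs [] = g xs fs"
    using assms unfolding definable_def by blast
  then show ?thesis
    by (intro definableI[OF S4[OF *]]) simp
qed

lemma definable_Suc: "definable l m f \<Longrightarrow> definable l m (\<lambda>xs fs. Suc (f xs fs))"
  using definable_Cons[OF definableI[OF S1, where f = "\<lambda>xs fs. Suc (hd xs)"]] by fastforce

lemma definable_apply:
  assumes "definable l m f" "k < m"
  shows "definable l m (\<lambda>xs fs. (fs ! k) (f xs fs))"
proof -
  have "definable (Suc l) m (\<lambda>xs fs. (fs ! k) (hd xs))"
  proof (cases m)
    case (Suc m')
    have "kleene_primrec (Suc l) m 0 (\<lambda>xs fs Fs. hd (to_front k fs) (hd xs))"
      using assms(2) unfolding Suc by (rule S6_1[OF S7])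
    then show ?thesis
      by (rule definableI) (simp add: to_front_def)
  qed (use assms in simp)
  from definable_Cons[OF this assms(1)] show ?thesis by simp
qed

text \<open>S5 recurses on the head of the list; S4 then substitutes an arbitrary definable count
  for that head.\<close>

lemma definable_rec_Cons:
  assumes "definable l m a" "definable (Suc (Suc l)) m b" "definable l m n"
  shows "definable l m (\<lambda>xs fs. rec_nat (a xs fs) (\<lambda>x y. b (x # y # xs) fs) (n xs fs))"
proof -
  obtain \<psi> \<theta> where *: "kleene_primrec l m 0 \<psi>" "kleene_primrec (Suc (Suc l)) m 0 \<theta>"
    and eq: "\<And>xs fs. length xs = l \<Longrightarrow> length fs = m \<Longrightarrow> \<psi> xs fs [] = a xs fs"
      "\<And>xs fs. length xs = Suc (Suc l) \<Longrightarrow> length fs = m \<Longrightarrow> \<theta> xs fs [] = b xs fs"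
    using assms unfolding definable_def by blast
  have "definable (Suc l) m
      (\<lambda>xs fs. rec_nat (a (tl xs) fs) (\<lambda>x y. b (x # y # tl xs) fs) (hd xs))"
    by (rule definableI[OF S5[OF *]]) (simp add: eq)
  from definable_Cons[OF this assms(3)] show ?thesis by simp
qed

text \<open>
  S4 and S5 put new arguments in front, so the induction needs arbitrary renamings of the
  number arguments, not just the weakenings derived from it below.
\<close>

lemma kleene_primrec_rename:
  assumes "kleene_primrec l m n \<psi>" "n = 0" "length js = l" "set js \<subseteq> {..<l'}"
  shows "definable l' m (\<lambda>xs fs. \<psi> (map ((!) xs) js) fs [])"
  using assms
proof (induction arbitrary: l' js rule: kleene_primrec.induct)
  case (S1 l m n)
  then obtain j js' where "js = j # js'" "j < l'" by (cases js) auto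
  then show ?case by (simp add: definable_Suc definable_nth)
next
  case (S2 l m n q)
  then show ?case by (simp add: definable_const)
next
  case (S3 l m n)
  then obtain j js' where "js = j # js'" "j < l'" by (cases js) auto
  then show ?case by (simp add: definable_nth)
next
  case (S4 l m n \<psi> \<theta>)
  \<comment> \<open>The value of \<open>\<theta>\<close> takes position 0, so every old index shifts
    by one.\<close>
  have "definable (Suc l') m (\<lambda>xs fs. \<psi> (map ((!) xs) (0 # map Suc js)) fs [])"
    using S4.prems by (intro S4.IH(1)) auto
  from definable_Cons[OF this S4.IH(2)[OF S4.prems]] show ?case
    by (simp add: comp_def)
next
  case (S5 l m n \<psi> \<theta>)
  then obtain j js' where js: "js = j # js'" "j < l'" "length js' = l" "set js' \<subseteq> {..<l'}"
    by (cases js) auto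
  \<comment> \<open>Counter and accumulator take positions 0 and 1; the recursion count is
    \<open>xs ! j\<close>.\<close>
  have "definable (Suc (Suc l')) m
      (\<lambda>xs fs. \<theta> (map ((!) xs) (0 # 1 # map (Suc \<circ> Suc) js')) fs [])"
    using S5.prems js by (intro S5.IH(2)) auto
  from definable_rec_Cons[OF S5.IH(1)[OF S5.prems(1) js(3,4)] this definable_nth[OF js(2)]]
  show ?case by (simp add: comp_def js(1))
next
  case (S6_0 l m n \<psi> k)
  have "definable l' m (\<lambda>xs fs. \<psi> (map ((!) xs) (to_front k js)) fs [])"
    using S6_0 set_to_front[of k js] by (intro S6_0.IH) (auto simp: length_to_front)
  then show ?case
    using S6_0 by (simp add: to_front_map)
next
  case (S6_1 l m n \<psi> k)
  obtain \<phi> where \<phi>: "kleene_primrec l' m 0 \<phi>"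
    "\<And>xs fs. length xs = l' \<Longrightarrow> length fs = m \<Longrightarrow> \<phi> xs fs [] = \<psi> (map ((!) xs) js) fs []"
    using S6_1.IH[OF S6_1.prems] unfolding definable_def by blast
  show ?case
    using S6_1.hyps(2)
    by (intro definableI[OF kleene_primrec.S6_1[OF \<phi>(1)]]) (auto simp: \<phi>(2) length_to_front)
next
  case (S7 l m n)
  then obtain j js' where js: "js = j # js'" "j < l'" by (cases js) auto
  have "definable l' (Suc m) (\<lambda>xs fs. (fs ! 0) (xs ! j))"
    by (intro definable_apply definable_nth js) simp
  then show ?case
    by (rule definable_cong) (simp add: js hd_conv_nth flip: length_greater_0_conv)
\<comment> \<open>S6 on type-2 arguments and S8 contradict \<open>n = 0\<close>.\<close>
qed auto

lemma definable_rename: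
  assumes "definable l m f" "length js = l" "set js \<subseteq> {..<l'}"
  shows "definable l' m (\<lambda>xs fs. f (map ((!) xs) js) fs)"
proof -
  obtain \<psi> where \<psi>: "kleene_primrec l m 0 \<psi>"
    "\<And>xs fs. length xs = l \<Longrightarrow> length fs = m \<Longrightarrow> \<psi> xs fs [] = f xs fs"
    using assms(1) unfolding definable_def by blast
  from kleene_primrec_rename[OF \<psi>(1) refl assms(2,3)] show ?thesis
    by (rule definable_cong) (simp add: \<psi>(2) assms)
qed

lemma map_nth_shift: "length xs = n + l \<Longrightarrow> map ((!) xs) [n..<n + l] = drop n xs"
  by (auto intro!: nth_equalityI)

lemma definable_tl:
  assumes "definable l m f"
  shows "definable (Suc l) m (\<lambda>xs fs. f (tl xs) fs)"
proof -
  have "definable (1 + l) m (\<lambda>xs fs. f (map ((!) xs) [1..<1 + l]) fs)"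
    by (rule definable_rename[OF assms]) auto
  then have "definable (1 + l) m (\<lambda>xs fs. f (tl xs) fs)"
    by (rule definable_cong) (simp only: map_nth_shift drop_Suc One_nat_def drop_0)
  then show ?thesis by simp
qed

text \<open>Lets a predicate of a search variable be evaluated inside a recursion, whose accumulator
  sits in second position.\<close>

lemma definable_skip_second:
  assumes "definable (Suc l) m f"
  shows "definable (Suc (Suc l)) m (\<lambda>xs fs. f (hd xs # tl (tl xs)) fs)"
proof -
  have "definable (2 + l) m (\<lambda>xs fs. f (map ((!) xs) (0 # [2..<2 + l])) fs)"
    by (rule definable_rename[OF assms]) auto
  then have "definable (2 + l) m (\<lambda>xs fs. f (hd xs # tl (tl xs)) fs)"
  proof (rule definable_cong)
    fix xs :: "nat list" and fs :: "(nat \<Rightarrow> nat) list"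
    assume "length xs = 2 + l"
    then have "map ((!) xs) (0 # [2..<2 + l]) = hd xs # tl (tl xs)"
      using map_nth_shift[of xs 2 l]
      by (cases xs) (auto simp: drop_Suc numeral_2_eq_2 simp del: upt_Suc)
    then show "f (map ((!) xs) (0 # [2..<2 + l])) fs = f (hd xs # tl (tl xs)) fs" by simp
  qed
  then show ?thesis by simp
qed

section \<open>Recursion and arithmetic\<close>

lemma definable_hd: "definable (Suc l) m (\<lambda>xs fs. hd xs)"
  by (rule definable_cong[OF definable_nth[of 0]]) (auto simp: length_Suc_conv)

lemma definable_hd_tl: "definable (Suc (Suc l)) m (\<lambda>xs fs. hd (tl xs))"
  by (rule definable_cong[OF definable_nth[of 1]]) (auto simp: length_Suc_conv)

lemma definable_hd_tl_tl: "definable (Suc (Suc (Suc l))) m (\<lambda>xs fs. hd (tl (tl xs)))"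
  by (rule definable_cong[OF definable_nth[of 2]]) (auto simp: length_Suc_conv)

text \<open>The recursion variables are separate arguments of \<open>b\<close>, so the rule applies
  to terms with bound variables; they become the first two list entries.\<close>

lemma definable_rec:
  assumes "definable l m a"
    and "definable (Suc (Suc l)) m (\<lambda>xs fs. b (hd xs) (hd (tl xs)) (tl (tl xs)) fs)"
    and "definable l m n"
  shows "definable l m (\<lambda>xs fs. rec_nat (a xs fs) (\<lambda>x y. b x y xs fs) (n xs fs))"
  using definable_rec_Cons[OF assms] by simp

lemma definable_add:
  assumes "definable l m f" "definable l m g"
  shows "definable l m (\<lambda>xs fs. f xs fs + g xs fs)"
proof -
  have [simp]: "rec_nat a (\<lambda>x. Suc) b = a + b" for a b by (induction b) auto
  have "definable l m (\<lambda>xs fs. rec_nat (f xs fs) (\<lambda>x y. Suc y) (g xs fs))"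
    by (intro definable_rec definable_Suc definable_hd_tl assms)
  then show ?thesis by simp
qed

lemma definable_mult:
  assumes "definable l m f" "definable l m g"
  shows "definable l m (\<lambda>xs fs. f xs fs * g xs fs)"
proof -
  have [simp]: "rec_nat 0 (\<lambda>x y. y + a) b = a * b" for a b :: nat by (induction b) auto
  have "definable l m (\<lambda>xs fs. rec_nat 0 (\<lambda>x y. y + f xs fs) (g xs fs))"
    by (intro definable_rec definable_const definable_add definable_hd_tl definable_tl assms)
  then show ?thesis by simp
qed

lemma definable_diff:
  assumes "definable l m f" "definable l m g"
  shows "definable l m (\<lambda>xs fs. f xs fs - g xs fs)"
proof -
  \<comment> \<open>Truncated subtraction iterates the predecessor, itself a recursion that returns
    its counter.\<close>
  have pred: "definable l m (\<lambda>xs fs. f xs fs - 1)" if "definable l m f" for f l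
  proof -
    have [simp]: "rec_nat 0 (\<lambda>x y. x) b = b - 1" for b :: nat by (cases b) auto
    have "definable l m (\<lambda>xs fs. rec_nat 0 (\<lambda>x y. x) (f xs fs))"
      by (intro definable_rec definable_const definable_hd that)
    then show ?thesis by simp
  qed
  have [simp]: "rec_nat a (\<lambda>x y. y - 1) b = a - b" for a b :: nat by (induction b) auto
  have "definable l m (\<lambda>xs fs. rec_nat (f xs fs) (\<lambda>x y. y - 1) (g xs fs))"
    by (intro definable_rec pred definable_hd_tl assms)
  then show ?thesis by (simp del: One_nat_def)
qed

lemma definable_power2:
  assumes "definable l m f"
  shows "definable l m (\<lambda>xs fs. 2 ^ f xs fs)"
proof -
  have [simp]: "rec_nat 1 (\<lambda>x y. y + y) b = (2 :: nat) ^ b" for b by (induction b) auto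
  have "definable l m (\<lambda>xs fs. rec_nat 1 (\<lambda>x y. y + y) (f xs fs))"
    by (intro definable_rec definable_const definable_add definable_hd_tl assms)
  then show ?thesis by (simp del: One_nat_def)
qed

lemma definable_prod_encode:
  assumes "definable l m f" "definable l m g"
  shows "definable l m (\<lambda>xs fs. prod_encode (f xs fs, g xs fs))"
proof -
  \<comment> \<open>Cantor pairing sends \<open>(m, n)\<close> to
    \<open>triangle (m + n) + m\<close>.\<close>
  have [simp]: "rec_nat 0 (\<lambda>x y. y + Suc x) b = triangle b" for b :: nat
    by (induction b) (auto simp: triangle_def)
  have "definable l m
      (\<lambda>xs fs. rec_nat 0 (\<lambda>x y. y + Suc x) (f xs fs + g xs fs) + f xs fs)"
    by (intro definable_rec definable_const definable_add definable_Suc definable_hd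
        definable_hd_tl assms)
  then show ?thesis by (simp add: prod_encode_def del: add_Suc_right)
qed

section \<open>Decidable predicates and bounded search\<close>

definition decidable ::
    "nat \<Rightarrow> nat \<Rightarrow> (nat list \<Rightarrow> (nat \<Rightarrow> nat) list \<Rightarrow> bool) \<Rightarrow> bool" where
  "decidable l m P \<longleftrightarrow> definable l m (\<lambda>xs fs. of_bool (P xs fs))"

lemma definable_if:
  assumes "decidable l m P" "definable l m f" "definable l m g"
  shows "definable l m (\<lambda>xs fs. if P xs fs then f xs fs else g xs fs)"
proof -
  \<comment> \<open>Recursion on the characteristic value takes zero steps or one, which is a case
    distinction.\<close>
  have "definable l m (\<lambda>xs fs. rec_nat (g xs fs) (\<lambda>x y. f xs fs) (of_bool (P xs fs)))"
    using assms unfolding decidable_def by (intro definable_rec definable_tl)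
  then show ?thesis
    by (rule definable_cong) simp
qed

lemma decidable_le:
  assumes "definable l m f" "definable l m g"
  shows "decidable l m (\<lambda>xs fs. f xs fs \<le> g xs fs)"
proof -
  have [simp]: "1 - (a - b) = of_bool (a \<le> b)" for a b :: nat by auto
  have "definable l m (\<lambda>xs fs. 1 - (f xs fs - g xs fs))"
    by (intro definable_diff definable_const assms)
  then show ?thesis unfolding decidable_def by (simp del: One_nat_def)
qed

lemma decidable_conj:
  assumes "decidable l m P" "decidable l m Q"
  shows "decidable l m (\<lambda>xs fs. P xs fs \<and> Q xs fs)"
  using definable_mult[OF assms[unfolded decidable_def]]
  by (simp add: decidable_def of_bool_conj)

lemma decidable_eq:
  assumes "definable l m f" "definable l m g"
  shows "decidable l m (\<lambda>xs fs. f xs fs = g xs fs)"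
  using decidable_conj[OF decidable_le[OF assms] decidable_le[OF assms(2,1)]]
  by (simp add: eq_iff)

lemma decidable_bounded_ex:
  assumes P: "decidable (Suc l) m (\<lambda>xs fs. P (hd xs) (tl xs) fs)" and "definable l m n"
  shows "decidable l m (\<lambda>xs fs. \<exists>i\<le>n xs fs. P i xs fs)"
proof -
  \<comment> \<open>\<open>Suc b\<close> rounds are needed for the bound \<open>b\<close> itself to
    be tested.\<close>
  have [simp]: "rec_nat 0 (\<lambda>x y. if Q x then 1 else y) (Suc b) = of_bool (\<exists>i\<le>b. Q i)" for Q b
    by (induction b) (auto simp: le_Suc_eq)
  have P': "decidable (Suc (Suc l)) m (\<lambda>xs fs. P (hd xs) (tl (tl xs)) fs)"
    using definable_skip_second[OF P[unfolded decidable_def]] by (simp add: decidable_def)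
  have "definable l m
      (\<lambda>xs fs. rec_nat 0 (\<lambda>x y. if P x xs fs then 1 else y) (Suc (n xs fs)))"
    by (intro definable_rec definable_const definable_Suc definable_if definable_hd_tl P' assms)
  then show ?thesis unfolding decidable_def by (simp del: nat.rec One_nat_def)
qed

text \<open>The largest solution up to \<open>n\<close>, or the junk value 0 if there is none.\<close>

definition search :: "nat \<Rightarrow> (nat \<Rightarrow> bool) \<Rightarrow> nat" where
  "search n P = rec_nat 0 (\<lambda>i y. if P i then i else y) (Suc n)"

lemma search_correct: "\<exists>i\<le>n. P i \<Longrightarrow> P (search n P)"
  unfolding search_def by (induction n) (simp, auto simp: le_Suc_eq, blast)

lemma definable_search:
  assumes P: "decidable (Suc l) m (\<lambda>xs fs. P (hd xs) (tl xs) fs)" and "definable l m n"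
  shows "definable l m (\<lambda>xs fs. search (n xs fs) (\<lambda>i. P i xs fs))"
proof -
  have P': "decidable (Suc (Suc l)) m (\<lambda>xs fs. P (hd xs) (tl (tl xs)) fs)"
    using definable_skip_second[OF P[unfolded decidable_def]] by (simp add: decidable_def)
  show ?thesis unfolding search_def
    by (intro definable_rec definable_const definable_Suc definable_if definable_hd
        definable_hd_tl P' assms)
qed

section \<open>Testing smallness of coded rationals\<close>

text \<open>
  A code \<open>\<langle>p, q\<rangle>\<close> stands for a rational of absolute value \<open>\<lceil>p/2\<rceil>/(q+1)\<close>. Replacing \<open>\<lceil>p/2\<rceil>\<close> by \<open>p\<close>
  costs a factor of at most 2 and makes the test expressible without division.
\<close>

definition tiny_code :: "nat \<Rightarrow> nat \<Rightarrow> bool" where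
  "tiny_code c k \<longleftrightarrow> (case prod_decode c of (p, q) \<Rightarrow> p * 2 ^ k \<le> q)"

lemma abs_rat_of_code:
  assumes "prod_decode c = (p, q)"
  shows "\<bar>real_of_rat (rat_of_code c)\<bar> = real ((p + 1) div 2) / real (Suc q)"
proof -
  have "\<bar>int_decode p\<bar> = int ((p + 1) div 2)"
    by (auto simp: int_decode_def sum_decode_def)
  then have "\<bar>real_of_int (int_decode p)\<bar> = real ((p + 1) div 2)"
    by (metis of_int_abs of_int_of_nat_eq)
  then show ?thesis
    by (simp add: rat_of_code_def assms of_rat_divide del: of_nat_Suc)
qed

lemma tiny_code_imp_less:
  assumes "tiny_code c k"
  shows "\<bar>real_of_rat (rat_of_code c)\<bar> < 1 / 2 ^ k"
proof -
  obtain p q where c: "prod_decode c = (p, q)" by fastforce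
  have "(p + 1) div 2 * 2 ^ k \<le> p * 2 ^ k" by (intro mult_right_mono) auto
  also have "\<dots> < Suc q" using assms c by (simp add: tiny_code_def)
  finally have "real ((p + 1) div 2) * 2 ^ k < real (Suc q)"
    by (metis of_nat_less_iff of_nat_mult of_nat_numeral of_nat_power)
  then show ?thesis unfolding abs_rat_of_code[OF c] by (simp add: field_simps)
qed

lemma less_imp_tiny_code:
  assumes "\<bar>real_of_rat (rat_of_code c)\<bar> < 1 / 2 ^ Suc k"
  shows "tiny_code c k"
proof -
  obtain p q where c: "prod_decode c = (p, q)" by fastforce
  from assms have "real ((p + 1) div 2) * 2 ^ Suc k < real (Suc q)"
    unfolding abs_rat_of_code[OF c] by (simp add: field_simps)
  then have "(p + 1) div 2 * 2 ^ Suc k < Suc q"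
    by (metis of_nat_less_iff of_nat_mult of_nat_numeral of_nat_power)
  moreover have "p * 2 ^ k \<le> (2 * ((p + 1) div 2)) * 2 ^ k" by (intro mult_right_mono) auto
  ultimately have "p * 2 ^ k < Suc q" by (simp only: power_Suc ac_simps)
  then show ?thesis by (simp add: tiny_code_def c)
qed

text \<open>Replaces decoding by a bounded search over pairs: both components are at most their
  code, and pairing is definable.\<close>

lemma tiny_code_iff:
  "tiny_code c k \<longleftrightarrow> (\<exists>p\<le>c. \<exists>q\<le>c. prod_encode (p, q) = c \<and> p * 2 ^ k \<le> q)"
proof -
  obtain p q where "prod_decode c = (p, q)" by fastforce
  then have "c = prod_encode (p, q)" by (metis prod_decode_inverse)
  then show ?thesis
    using le_prod_encode_1[of p q] le_prod_encode_2[of q p] by (auto simp: tiny_code_def)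
qed

lemma decidable_tiny_code:
  assumes "definable l m f" "definable l m g"
  shows "decidable l m (\<lambda>xs fs. tiny_code (f xs fs) (g xs fs))"
proof -
  show ?thesis unfolding tiny_code_iff
    by (intro decidable_bounded_ex decidable_conj decidable_eq decidable_le definable_prod_encode
        definable_mult definable_power2 definable_hd definable_hd_tl definable_tl assms)
qed

text \<open>Approximation error and bound on \<open>x\<close> add up to
  \<open>1 / 2 ^ Suc k\<close>, the threshold of \<open>less_imp_tiny_code\<close>.\<close>

lemma name_tiny_codeI:
  assumes "is_name f x" "\<bar>x\<bar> < 1 / 2 ^ (k + 2)"
  shows "tiny_code (f (k + 2)) k"
proof (rule less_imp_tiny_code)
  have "\<bar>x - of_rat (rat_of_code (f (k + 2)))\<bar> \<le> 1 / 2 ^ (k + 2)"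
    using assms(1) unfolding is_name_def by blast
  moreover have "(1::real) / 2 ^ Suc k = 1 / 2 ^ (k + 2) + 1 / 2 ^ (k + 2)" by simp
  ultimately show "\<bar>real_of_rat (rat_of_code (f (k + 2)))\<bar> < 1 / 2 ^ Suc k"
    using assms(2) by linarith
qed

lemma name_tiny_codeD:
  assumes "is_name f x" "tiny_code (f (k + 2)) k"
  shows "\<bar>x\<bar> < 2 / 2 ^ k"
proof -
  have "\<bar>x - of_rat (rat_of_code (f (k + 2)))\<bar> \<le> 1 / 2 ^ (k + 2)"
    using assms(1) unfolding is_name_def by blast
  moreover have "(1::real) / 2 ^ (k + 2) \<le> 1 / 2 ^ k"
    by (intro divide_left_mono power_increasing) auto
  ultimately show ?thesis
    using tiny_code_imp_less[OF assms(2)] by linarith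
qed

section \<open>The sequence of approximate zeros\<close>

text \<open>A passed test at precision \<open>\<rho> (n + 5) + 1\<close> bounds the value of
  \<open>F\<close> by \<open>1 / 2 ^ \<rho> (n + 5)\<close>, since the test loses a factor 2. The
  \<open>+ 2\<close> is the precision at which the name is read.\<close>

definition near_zero :: "(nat \<Rightarrow> nat) \<Rightarrow> (nat \<Rightarrow> nat) \<Rightarrow> nat \<Rightarrow> nat \<Rightarrow> bool" where
  "near_zero H \<rho> n i \<longleftrightarrow> tiny_code (H (prod_encode (i, \<rho> (n + 5) + 1 + 2))) (\<rho> (n + 5) + 1)"

text \<open>The sum stands in for a maximum: one covering point is close enough both for
  \<open>\<omega>\<close> and for the distance \<open>1 / 2 ^ (n + 5)\<close>.\<close>

definition search_bound :: "(nat \<Rightarrow> nat) \<Rightarrow> (nat \<Rightarrow> nat) \<Rightarrow> (nat \<Rightarrow> nat) \<Rightarrow> nat \<Rightarrow> nat" where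
  "search_bound \<omega> \<alpha> \<rho> n = \<alpha> (\<omega> (\<rho> (n + 5) + 1 + 2) + (n + 5))"

text \<open>
  Stage \<open>n\<close> yields a point within \<open>2\<^sup>-\<^sup>n\<^sup>-\<^sup>5\<close> of a zero; the offset 5 absorbs the losses of the
  tests, so that consecutive points are within \<open>2\<^sup>-\<^sup>n\<^sup>-\<^sup>1\<close> of each other.
\<close>

definition zero_index ::
    "(nat \<Rightarrow> nat) \<Rightarrow> (nat \<Rightarrow> nat) \<Rightarrow> (nat \<Rightarrow> nat) \<Rightarrow> (nat \<Rightarrow> nat) \<Rightarrow> (nat \<Rightarrow> nat) \<Rightarrow> nat \<Rightarrow> nat" where
  "zero_index \<omega> \<alpha> G H \<rho> = rec_nat (search (search_bound \<omega> \<alpha> \<rho> 0) (near_zero H \<rho> 0))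
    (\<lambda>n p. search (search_bound \<omega> \<alpha> \<rho> (Suc n))
      (\<lambda>i. near_zero H \<rho> (Suc n) i \<and>
        tiny_code (G (prod_encode (prod_encode (p, i), n + 2 + 2))) (n + 2)))"

lemma definable_zero_index:
  "definable 1 5 (\<lambda>xs fs. zero_index (fs ! 0) (fs ! 1) (fs ! 2) (fs ! 3) (fs ! 4) (hd xs))"
  unfolding zero_index_def near_zero_def search_bound_def One_nat_def
  \<comment> \<open>Under the recursion and the search the number list starts with \<open>i\<close>,
    \<open>n\<close>, \<open>p\<close>.\<close>
  by (intro definable_rec definable_search definable_apply definable_add definable_prod_encode
      definable_const definable_Suc definable_hd definable_hd_tl definable_hd_tl_tl
      decidable_conj decidable_tiny_code) simp_all

section \<open>Geometric convergence in complete metric spaces\<close>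

context Metric_space
begin

text \<open>The subtracted \<open>1 / 2 ^ k\<close> makes the induction close: each step uses up
  exactly \<open>1 / 2 ^ (k + 1)\<close> of it.\<close>

lemma telescoping_dist_le:
  assumes "\<And>n. x n \<in> M" "\<And>n. d (x n) (x (Suc n)) \<le> 1 / 2 ^ (n + 1)" "n \<le> k"
  shows "d (x n) (x k) \<le> 1 / 2 ^ n - 1 / 2 ^ k"
  using assms(3)
proof (induction k rule: dec_induct)
  case base
  then show ?case using assms(1) by simp
next
  case (step k)
  have "d (x n) (x (Suc k)) \<le> d (x n) (x k) + d (x k) (x (Suc k))"
    by (intro triangle assms)
  moreover have "(1::real) / 2 ^ k = 1 / 2 ^ (k + 1) + 1 / 2 ^ (k + 1)" by simp
  ultimately show ?case
    using step.IH assms(2)[of k] unfolding Suc_eq_plus1 by linarith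
qed

lemma mcomplete_geometric_limit:
  assumes "mcomplete" "\<And>n. x n \<in> M" "\<And>n. d (x n) (x (Suc n)) \<le> 1 / 2 ^ (n + 1)"
  obtains l where "l \<in> M" "\<And>n. d (x n) l \<le> 1 / 2 ^ n"
proof -
  have le: "d (x n) (x k) \<le> 1 / 2 ^ n" if "n \<le> k" for n k
  proof -
    have "(0::real) \<le> 1 / 2 ^ k" by simp
    with telescoping_dist_le[of x, OF assms(2,3) that] show ?thesis by linarith
  qed
  have "MCauchy x" unfolding MCauchy_def
  proof (intro conjI allI impI)
    show "range x \<subseteq> M" using assms(2) by blast
    fix \<epsilon> :: real assume "\<epsilon> > 0"
    then obtain N where "(1 / 2) ^ N < \<epsilon> / 2"
      using real_arch_pow_inv[of "\<epsilon> / 2" "1 / 2"] by auto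
    then have N: "1 / 2 ^ N < \<epsilon> / 2" by (simp add: power_divide)
    have "d (x n) (x k) < \<epsilon>" if "N \<le> n" "N \<le> k" for n k
      using le[OF that(1)] le[OF that(2)] N triangle''[of "x n" "x N" "x k"] assms(2)
      by (smt (verit) field_sum_of_halves)
    then show "\<exists>N. \<forall>n k. N \<le> n \<longrightarrow> N \<le> k \<longrightarrow> d (x n) (x k) < \<epsilon>" by blast
  qed
  then obtain l where l: "limitin mtopology x l sequentially"
    using assms(1) unfolding mcomplete_def by blast
  then have "l \<in> M" by (rule limitin_mspace)
  moreover have "d (x n) l \<le> 1 / 2 ^ n" for n
  proof (rule field_le_epsilon)
    fix \<epsilon> :: real assume "\<epsilon> > 0"
    with l obtain K where K: "\<And>k. k \<ge> K \<Longrightarrow> d (x k) l < \<epsilon>"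
      unfolding limit_metric_sequentially by blast
    define k where "k = max n K"
    \<comment> \<open>A detour through a late term \<open>x k\<close> carries the uniform bound over
      to the limit.\<close>
    have "d (x n) l \<le> d (x n) (x k) + d (x k) l" by (intro triangle assms \<open>l \<in> M\<close>)
    also have "\<dots> \<le> 1 / 2 ^ n + \<epsilon>"
      using le[of n k] K[of k] by (auto simp: k_def)
    finally show "d (x n) l \<le> 1 / 2 ^ n + \<epsilon>" .
  qed
  ultimately show thesis by (rule that)
qed

lemma zero_index_converges:
  fixes a :: "nat \<Rightarrow> 'a" and F :: "'a \<Rightarrow> real"
  assumes complete: "mcomplete" and a: "\<And>n. a n \<in> M"
    and \<alpha>: "\<forall>x\<in>M. \<forall>k. \<exists>i\<le>\<alpha> k. d x (a i) < 1 / 2 ^ k"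
    and g: "\<forall>i j. is_name (g (i, j)) (d (a i) (a j))"
    and \<omega>: "modulus_of_uniform_continuity M d F \<omega>"
    and h: "\<forall>i. is_name (h i) (F (a i))"
    and \<rho>: "modulus_of_regularity M d F \<rho>"
    and zer: "zer M F \<noteq> {}"
  shows "\<exists>x\<in>zer M F. \<forall>k. d (a (zero_index \<omega> \<alpha> (code2 g) (code1 h) \<rho> k)) x \<le> 1 / 2 ^ k"
proof -
  define \<beta> where "\<beta> = zero_index \<omega> \<alpha> (code2 g) (code1 h) \<rho>"
  define r where "r n = \<rho> (n + 5)" for n
  let ?near = "near_zero (code1 h) \<rho>" and ?N = "search_bound \<omega> \<alpha> \<rho>"
  let ?close = "\<lambda>n p i. tiny_code (g (p, i) (n + 2 + 2)) (n + 2)"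
  have \<beta>_0: "\<beta> 0 = search (?N 0) (?near 0)"
    by (simp add: \<beta>_def zero_index_def)
  have \<beta>_Suc: "\<beta> (Suc n) = search (?N (Suc n)) (\<lambda>i. ?near (Suc n) i \<and> ?close n (\<beta> n) i)" for n
    by (simp add: \<beta>_def zero_index_def code2_def code1_def)
  have near_iff: "?near n i \<longleftrightarrow> tiny_code (h i (r n + 1 + 2)) (r n + 1)" for n i
    by (simp add: near_zero_def code1_def r_def)
  have near_zer: "\<exists>z\<in>zer M F. d (a i) z < 1 / 2 ^ (n + 5)" if "?near n i" for n i
  proof -
    have "\<bar>F (a i)\<bar> < 2 / 2 ^ (r n + 1)"
      using that h unfolding near_iff by (intro name_tiny_codeD) auto
    then have "\<bar>F (a i)\<bar> < 1 / 2 ^ \<rho> (n + 5)" by (simp add: r_def)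
    then show ?thesis using \<rho> a unfolding modulus_of_regularity_def by blast
  qed
  have near_ex: "\<exists>i\<le>?N n. d z (a i) < 1 / 2 ^ (n + 5) \<and> ?near n i" if z: "z \<in> zer M F" for n z
  proof -
    define e where "e = \<omega> (r n + 1 + 2)"
    have zM: "z \<in> M" and Fz: "F z = 0" using z by (auto simp: zer_def)
    obtain i where i: "i \<le> \<alpha> (e + (n + 5))" "d z (a i) < 1 / 2 ^ (e + (n + 5))"
      using \<alpha> zM by blast
    have "(1::real) / 2 ^ (e + (n + 5)) \<le> 1 / 2 ^ e"
      "(1::real) / 2 ^ (e + (n + 5)) \<le> 1 / 2 ^ (n + 5)"
      by (intro divide_left_mono power_increasing; simp)+
    with i(2) have *: "d z (a i) < 1 / 2 ^ e" "d z (a i) < 1 / 2 ^ (n + 5)"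
      by linarith+
    have "\<bar>F z - F (a i)\<bar> < 1 / 2 ^ (r n + 1 + 2)"
      using \<omega> zM a *(1) unfolding modulus_of_uniform_continuity_def e_def by blast
    then have "\<bar>F (a i)\<bar> < 1 / 2 ^ (r n + 1 + 2)" by (simp add: Fz)
    then have "?near n i"
      using h unfolding near_iff by (intro name_tiny_codeI) auto
    with * i(1) show ?thesis by (auto simp: search_bound_def e_def r_def)
  qed
  have step: "?near (Suc n) (\<beta> (Suc n)) \<and> ?close n (\<beta> n) (\<beta> (Suc n))" if near: "?near n (\<beta> n)" for n
  proof -
    obtain z where z: "z \<in> zer M F" "d (a (\<beta> n)) z < 1 / 2 ^ (n + 5)"
      using near_zer[OF near] by blast
    obtain i where i: "i \<le> ?N (Suc n)" "d z (a i) < 1 / 2 ^ (Suc n + 5)" "?near (Suc n) i"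
      using near_ex[OF z(1)] by blast
    have zM: "z \<in> M" using z by (simp add: zer_def)
    have "d (a (\<beta> n)) (a i) \<le> d (a (\<beta> n)) z + d z (a i)" by (intro triangle a zM)
    also have "\<dots> < 1 / 2 ^ (n + 5) + 1 / 2 ^ (Suc n + 5)" using z i by linarith
    \<comment> \<open>This is the margin that guarantees a passed closeness test at precision
      \<open>n + 2\<close>.\<close>
    also have "\<dots> < 1 / 2 ^ (n + 2 + 2)" by (simp add: power_add field_simps)
    finally have "?close n (\<beta> n) i"
      using g by (intro name_tiny_codeI) auto
    \<comment> \<open>The search may return an index other than this witness, but one passing both
      tests.\<close>
    with i have "\<exists>i\<le>?N (Suc n). ?near (Suc n) i \<and> ?close n (\<beta> n) i" by blast
    then show ?thesis unfolding \<beta>_Suc by (rule search_correct)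
  qed
  have near: "?near n (\<beta> n)" for n
  proof (induction n)
    case 0
    obtain z where "z \<in> zer M F" using zer by blast
    then have "\<exists>i\<le>?N 0. ?near 0 i" using near_ex by blast
    then show ?case unfolding \<beta>_0 by (rule search_correct)
  qed (use step in blast)
  have "d (a (\<beta> n)) (a (\<beta> (Suc n))) \<le> 1 / 2 ^ (n + 1)" for n
  proof -
    have "\<bar>d (a (\<beta> n)) (a (\<beta> (Suc n)))\<bar> < 2 / 2 ^ (n + 2)"
      using g step[OF near] by (intro name_tiny_codeD) auto
    then show ?thesis by simp
  qed
  from mcomplete_geometric_limit[of "\<lambda>n. a (\<beta> n)", OF complete a this]
  obtain x where x: "x \<in> M" "\<And>n. d (a (\<beta> n)) x \<le> 1 / 2 ^ n" by blast
  have "\<bar>F x\<bar> < 1 / 2 ^ k" for k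
  proof -
    \<comment> \<open>The extra 1 leaves room for two errors: \<open>a (\<beta> n)\<close> to its
      nearby zero and to \<open>x\<close>. As the zero \<open>z\<close> varies with
      \<open>k\<close>, only the smallness of \<open>F x\<close> follows at first.\<close>
    define n where "n = \<omega> k + 1"
    obtain z where z: "z \<in> zer M F" "d (a (\<beta> n)) z < 1 / 2 ^ (n + 5)"
      using near_zer[OF near] by blast
    have zM: "z \<in> M" "F z = 0" using z by (auto simp: zer_def)
    have "d z x \<le> d (a (\<beta> n)) z + d (a (\<beta> n)) x"
      using triangle''[of z "a (\<beta> n)" x] a x(1) zM(1) by (simp add: commute)
    also have "\<dots> < 1 / 2 ^ (n + 5) + 1 / 2 ^ n" using z x(2)[of n] by linarith
    also have "\<dots> < 1 / 2 ^ \<omega> k" by (simp add: n_def power_add field_simps)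
    finally have "\<bar>F z - F x\<bar> < 1 / 2 ^ k"
      using \<omega> zM(1) x(1) unfolding modulus_of_uniform_continuity_def by blast
    then show ?thesis by (simp add: zM)
  qed
  then have small: "\<bar>F x\<bar> < (1 / 2) ^ k" for k by (simp add: power_divide)
  have "F x = 0"
  proof (rule ccontr)
    assume "F x \<noteq> 0"
    then obtain k where "(1 / 2) ^ k < \<bar>F x\<bar>"
      using real_arch_pow_inv[of "\<bar>F x\<bar>" "1 / 2"] by auto
    with small[of k] show False by linarith
  qed
  with x show ?thesis by (auto simp: zer_def \<beta>_def)
qed

end

theorem theorem2p3:
  fixes X :: "'a set" and d :: "'a \<Rightarrow> 'a \<Rightarrow> real" and a :: "nat \<Rightarrow> 'a" and F :: "'a \<Rightarrow> real"
  assumes "Metric_space X d"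
    and "compact_space (Metric_space.mtopology X d)"
    and "\<And>n. a n \<in> X"
    and "continuous_map (Metric_space.mtopology X d) euclideanreal F"
  shows "\<exists>\<Phi>. kleene_primrec 1 5 0 \<Phi> \<and>
    (\<forall>(\<omega> :: nat \<Rightarrow> nat) (\<alpha> :: nat \<Rightarrow> nat) (\<rho> :: nat \<Rightarrow> nat)
        (g :: nat \<times> nat \<Rightarrow> nat \<Rightarrow> nat) (h :: nat \<Rightarrow> nat \<Rightarrow> nat).
      (\<forall>x\<in>X. \<forall>k. \<exists>i\<le>\<alpha> k. d x (a i) < 1 / 2 ^ k) \<longrightarrow>
      (\<forall>i j. is_name (g (i, j)) (d (a i) (a j))) \<longrightarrow>
      modulus_of_uniform_continuity X d F \<omega> \<longrightarrow>
      (\<forall>i. is_name (h i) (F (a i))) \<longrightarrow>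
      modulus_of_regularity X d F \<rho> \<longrightarrow>
      zer X F \<noteq> {} \<longrightarrow>
      (let \<beta> = (\<lambda>k. \<Phi> [k] [\<omega>, \<alpha>, code2 g, code1 h, \<rho>] []) in
        \<exists>x\<in>zer X F. \<forall>k. d (a (\<beta> k)) x \<le> 1 / 2 ^ k))"
proof -
  interpret Metric_space X d by fact
  \<comment> \<open>Completeness supplies the limit of the constructed sequence.\<close>
  have "mcomplete" using assms(2) by (rule compact_space_imp_mcomplete)
  note conv = zero_index_converges[OF this assms(3)]
  \<comment> \<open>\<open>zero_index\<close> is built from number-theoretic data alone, so one
    \<open>\<Phi>\<close> serves all moduli and names.\<close>
  obtain \<Phi> where \<Phi>: "kleene_primrec 1 5 0 \<Phi>"
    and eq: "\<And>xs fs. length xs = 1 \<Longrightarrow> length fs = 5 \<Longrightarrow>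
      \<Phi> xs fs [] = zero_index (fs ! 0) (fs ! 1) (fs ! 2) (fs ! 3) (fs ! 4) (hd xs)"
    using definable_zero_index unfolding definable_def by blast
  have "\<Phi> [k] [\<omega>, \<alpha>, G, H, \<rho>] [] = zero_index \<omega> \<alpha> G H \<rho> k" for k \<omega> \<alpha> G H \<rho>
    by (simp add: eq)
  with \<Phi> conv show ?thesis unfolding Let_def
    by (intro exI[of _ \<Phi>] conjI allI impI) simp_all
qed

end
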